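(* Assume that $n\ge 4$ and $0\le k\le n$. Then every collection in the packet $\mathcal P(n,k)$ contains exactly $C(n,k)$ elements, where $C(n,k)$ is the $(n,k)$-entry of Catalan's triangle.
   Context: Words are finite sequences over the alphabet $I=\{1,\dots,n\}$, the vertex set of the Dynkin diagram of type $D_n$: two letters are neighbors iff they are $\{i,i+1\}$ with $1\le i\le n-2$, or $\{n-2,n\}$. Juxtaposition of words is concatenation and $[~]$ is the empty word. A word $[w_1,\dots,w_d]$ is homogeneous if whenever $w_r=w_s$ with $r<s$, there exist $t,u$ with $r<t<u<s$ such that $w_r$ is a neighbor of both $w_t$ and $w_u$. For $1\le i\le n-1$ let $s_{ij}=[i,i-1,\dots,j]$ if $i\ge j$ and $s_{ij}=[~]$ if $i<j$. Let $s_{nj}=[n,n-2,n-3,\dots,j]$ if $j\le n-2$, $s_{nj}=[n]$ if $j\in\{n-1,n\}$, and $s_{nj}=[~]$ if $j>n$. Write $s_i=s_{ii}$. A prefix is a word $s_{1i_1}s_{2i_2}\cdots s_{n-1\,i_{n-1}}$ with $1\le i_m\le m+1$ for $1\le m\le n-1$. A suffix is a word $s_{nj_1}s_{n-1\,j_2}s_{nj_3}s_{n-1\,j_4}\cdots s_{n-1+[\ell]_2\,j_\ell}$ with $\ell\ge 0$ and $1\le j_1<j_2<\cdots<j_\ell\le n-1$, where $[\ell]_2=1$ if $\ell$ is odd and $0$ if $\ell$ is even. Let $\mathcal W_n$ be the set of words $\boldsymbol w_0\boldsymbol w'$ with $\boldsymbol w_0$ a prefix and $\boldsymbol w'$ a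 suffix; these are canonical reduced words, one for each element of the Coxeter group of type $D_n$, and $\boldsymbol w'$ is called the suffix of $\boldsymbol w_0\boldsymbol w'$. For a suffix $\boldsymbol w'$, the collection $\mathbf c^n_{\boldsymbol w'}$ is the set of homogeneous words in $\mathcal W_n$ whose suffix is $\boldsymbol w'$. The $(n,k)$-packet $\mathcal P(n,k)$, $0\le k\le n$, is the following set of collections: - $\mathcal P(n,0)$: the collections labeled by suffixes $s_{n1}s_{n-1\,j_2}s_{nj_3}\cdots s_{n-1+[\ell]_2\,j_\ell}$ with $\ell\ge2$ (so $j_1=1$). - $\mathcal P(n,k)$, $1\le k\le n-3$: the collections labeled by $s_{nk}$ or by suffixes $s_{n\,k+1}s_{n-1\,j_2}s_{nj_3}\cdots s_{n-1+[\ell]_2\,j_\ell}$ with $\ell\ge 2$ (so $j_1=k+1$). - $\mathcal P(n,n-2)$: only the collection labeled by $s_{n\,n-2}=[n,n-2]$. - $\mathcal P(n,n-1)$: only the collection labeled by $s_n=[n]$. - $\mathcal P(n,n)$: only the collection labeled by the empty suffix $[~]$. Catalan's triangle: for $n\ge0$, $0\le k\le n$, $C(0,0)=1$ and, for $n\ge1$, $C(n,0)=C(n-1,0)$, $C(n,k)=C(n,k-1)+C(n-1,k)$ for $0<k<n$, and $C(n,n)=C(n,n-1)$. Equivalently $C(n,k)=\frac{(n+k)!\,(n-k+1)}{k!\,(n+1)!}$. *)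

theory Defs
  imports Main
begin

definition neighbor :: "nat \<Rightarrow> nat \<Rightarrow> nat \<Rightarrow> bool" where
  "neighbor n a b \<longleftrightarrow> (\<exists>i\<in>{1..n - 2}. {a, b} = {i, i + 1}) \<or> {a, b} = {n - 2, n}"

definition homogeneous :: "nat \<Rightarrow> nat list \<Rightarrow> bool" where
  "homogeneous n w \<longleftrightarrow>
    (\<forall>r s. r < s \<and> s < length w \<and> w ! r = w ! s \<longrightarrow>
      (\<exists>t u. r < t \<and> t < u \<and> u < s \<and>
        neighbor n (w ! r) (w ! t) \<and> neighbor n (w ! r) (w ! u)))"

text \<open>
  \<open>seg n i j\<close> is the word \<open>s\<^sub>i\<^sub>j\<close>, meant for \<open>1 \<le> i \<le> n\<close> and \<open>1 \<le> j\<close>. Note that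
  \<open>rev [j..<Suc i]\<close> is \<open>[i, i - 1, \<dots>, j]\<close>, and is empty if \<open>i < j\<close>.
\<close>

definition seg :: "nat \<Rightarrow> nat \<Rightarrow> nat \<Rightarrow> nat list" where
  "seg n i j =
    (if i = n
     then (if j \<le> n - 2 then n # rev [j..<Suc (n - 2)]
           else if j = n - 1 \<or> j = n then [n] else [])
     else rev [j..<Suc i])"

definition prefixes :: "nat \<Rightarrow> nat list set" where
  "prefixes n =
    {concat (map (\<lambda>m. seg n m (i m)) [1..<n]) | i :: nat \<Rightarrow> nat.
      \<forall>m. 1 \<le> m \<and> m \<le> n - 1 \<longrightarrow> 1 \<le> i m \<and> i m \<le> m + 1}"

definition suffix_indices :: "nat \<Rightarrow> nat list set" where
  "suffix_indices n = {js. sorted_wrt (<) js \<and> set js \<subseteq> {1..n - 1}}"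

text \<open>
  The list \<open>js\<close> is indexed from 0, so the factor \<open>s\<^sub>n\<^sub>j\<close> occurs at the even positions.
\<close>

definition suffix_word :: "nat \<Rightarrow> nat list \<Rightarrow> nat list" where
  "suffix_word n js =
    concat (map (\<lambda>r. seg n (if even r then n else n - 1) (js ! r)) [0..<length js])"

definition suffixes :: "nat \<Rightarrow> nat list set" where
  "suffixes n = suffix_word n ` suffix_indices n"

definition canonical_words :: "nat \<Rightarrow> nat list set" where
  "canonical_words n = {w0 @ w' | w0 w'. w0 \<in> prefixes n \<and> w' \<in> suffixes n}"

text \<open>
  The letter \<open>n\<close> occurs in no prefix, while every nonempty suffix begins with it; hence
  the factorization of a canonical word into a prefix and a suffix is unique.
\<close>

definition collection :: "nat \<Rightarrow> nat list \<Rightarrow> nat list set" where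
  "collection n w' =
    {w \<in> canonical_words n. homogeneous n w \<and> (\<exists>w0\<in>prefixes n. w = w0 @ w')}"

definition long_suffixes_from :: "nat \<Rightarrow> nat \<Rightarrow> nat list set" where
  "long_suffixes_from n j =
    {suffix_word n js | js. js \<in> suffix_indices n \<and> 2 \<le> length js \<and> hd js = j}"

definition packet_labels :: "nat \<Rightarrow> nat \<Rightarrow> nat list set" where
  "packet_labels n k =
    (if k = 0 then long_suffixes_from n 1
     else if k \<le> n - 3 then {seg n n k} \<union> long_suffixes_from n (k + 1)
     else if k = n - 2 then {seg n n (n - 2)}
     else if k = n - 1 then {seg n n n}
     else if k = n then {[]}
     else {})"

definition packet :: "nat \<Rightarrow> nat \<Rightarrow> nat list set set" where
  "packet n k = collection n ` packet_labels n k"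

text \<open>Catalan's triangle, extended by 0 to \<open>k > n\<close>.\<close>

fun catalan_triangle :: "nat \<Rightarrow> nat \<Rightarrow> nat" where
  "catalan_triangle 0 k = (if k = 0 then 1 else 0)"
| "catalan_triangle (Suc n) 0 = catalan_triangle n 0"
| "catalan_triangle (Suc n) (Suc k) =
    (if k < n then catalan_triangle (Suc n) k + catalan_triangle n (Suc k)
     else if k = n then catalan_triangle (Suc n) k
     else 0)"

end

theory Submission
  imports Defs
begin

text \<open>
  Read a word from left to right and record, for every letter \<open>a\<close>, the number of neighbors of \<open>a\<close>
  seen since the last \<open>a\<close>. A homogeneous word stays homogeneous after appending \<open>a\<close> iff \<open>a\<close> is new or
  this number is at least 2. Inside a descending factor \<open>s\<^sub>i\<^sub>j\<close> each letter gains one neighbor from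
  its predecessor, so appending the factor to a prefix only requires that the prefix has no right
  descent (no letter with number 0) in an interval; afterwards \<open>j\<close> is a right descent, all
  larger letters are not, and among the smaller ones only \<open>j - 1\<close> may stop being one.

  Hence the homogeneous words whose suffix has at least two factors and starts with \<open>s\<^sub>n\<^sub>,\<^sub>k\<^sub>+\<^sub>1\<close>
  correspond to the homogeneous prefixes \<open>G(n, k)\<close> all of whose descents are at most \<open>k\<close>, and
  those with suffix \<open>s\<^sub>n\<^sub>k\<close> to the homogeneous prefixes \<open>A(n, k)\<close> without descents in
  \<open>{k, \<dots>, n - 2}\<close>. Splitting off the last factor of the prefix gives
  \<open>|G(m + 1, k)| = |G(m, 0)| + \<cdots> + |G(m, k)|\<close> and \<open>|A(m + 1, k)| = |G(m + 1, k - 1)| + |A(m, k)|\<close>, both of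
  which are recurrences of Catalan's triangle.
\<close>

section \<open>Testing homogeneity letter by letter\<close>

text \<open>
  The initial value 2 makes \<open>2 \<le> room n w a\<close> the condition for appending \<open>a\<close> also when \<open>a\<close> does
  not occur in \<open>w\<close>.
\<close>

definition room :: "nat \<Rightarrow> nat list \<Rightarrow> nat \<Rightarrow> nat" where
  "room n w = foldl (\<lambda>f b a. if a = b then 0 else f a + of_bool (neighbor n a b)) (\<lambda>_. 2) w"

lemma room_Nil [simp]: "room n [] a = 2"
  by (simp add: room_def)

lemma room_snoc [simp]:
  "room n (w @ [b]) a = (if a = b then 0 else room n w a + of_bool (neighbor n a b))"
  by (simp add: room_def)

text \<open>Only the last \<open>a\<close> is binding, as earlier ones have at least as many
  neighbors after them. The bound \<open>c\<close> is general because appending a neighbor of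
  \<open>a\<close> lowers the demand on the shorter word by one; as \<open>c\<close> is at most 2,
  the initial value never obstructs.\<close>

lemma le_room_iff:
  assumes "c \<le> 2"
  shows "c \<le> room n w a \<longleftrightarrow>
    (\<forall>r < length w. w ! r = a \<longrightarrow> c \<le> length (filter (neighbor n a) (drop (Suc r) w)))"
  using assms
proof (induction w arbitrary: c rule: rev_induct)
  case (snoc b w)
  let ?f = "\<lambda>w r. length (filter (neighbor n a) (drop (Suc r) w))"
  have "(\<forall>r < length (w @ [b]). (w @ [b]) ! r = a \<longrightarrow> c \<le> ?f (w @ [b]) r) \<longleftrightarrow>
      (b = a \<longrightarrow> c = 0) \<and>
      (\<forall>r < length w. w ! r = a \<longrightarrow> c - of_bool (neighbor n a b) \<le> ?f w r)"
    unfolding length_append_singleton All_less_Suc by (auto simp: nth_append)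
  also have "\<dots> \<longleftrightarrow> (b = a \<longrightarrow> c = 0) \<and> c - of_bool (neighbor n a b) \<le> room n w a"
    using snoc.prems by (subst snoc.IH) simp_all
  also have "\<dots> \<longleftrightarrow> c \<le> room n (w @ [b]) a"
    by auto
  finally show ?case ..
qed simp

lemma two_le_length_filter_iff:
  "2 \<le> length (filter P xs) \<longleftrightarrow> (\<exists>t u. t < u \<and> u < length xs \<and> P (xs ! t) \<and> P (xs ! u))"
proof -
  let ?S = "{i. i < length xs \<and> P (xs ! i)}"
  have "2 \<le> card ?S \<longleftrightarrow> \<not> card ?S \<le> Suc 0" by auto
  also have "\<dots> \<longleftrightarrow> (\<exists>t\<in>?S. \<exists>u\<in>?S. t \<noteq> u)"
    by (subst card_le_Suc0_iff_eq) auto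
  also have "\<dots> \<longleftrightarrow> (\<exists>t\<in>?S. \<exists>u\<in>?S. t < u)"
    unfolding nat_neq_iff by blast
  also have "\<dots> \<longleftrightarrow> (\<exists>t u. t < u \<and> u < length xs \<and> P (xs ! t) \<and> P (xs ! u))"
    using less_trans[of _ _ "length xs"] by blast
  finally show ?thesis unfolding length_filter_conv_card .
qed

lemma two_le_room_iff:
  "2 \<le> room n w a \<longleftrightarrow>
    (\<forall>r < length w. w ! r = a \<longrightarrow>
      (\<exists>t u. r < t \<and> t < u \<and> u < length w \<and> neighbor n a (w ! t) \<and> neighbor n a (w ! u)))"
proof -
  have "2 \<le> length (filter P (drop (Suc r) w)) \<longleftrightarrow>
      (\<exists>t u. r < t \<and> t < u \<and> u < length w \<and> P (w ! t) \<and> P (w ! u))"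
    if "r < length w" for r P
  proof
    assume "2 \<le> length (filter P (drop (Suc r) w))"
    then obtain t u where "t < u" "u < length w - Suc r" "P (w ! (Suc r + t))" "P (w ! (Suc r + u))"
      using that by (auto simp: two_le_length_filter_iff)
    then show "\<exists>t u. r < t \<and> t < u \<and> u < length w \<and> P (w ! t) \<and> P (w ! u)"
      by (intro exI[of _ "Suc r + t"] exI[of _ "Suc r + u"]) auto
  next
    assume "\<exists>t u. r < t \<and> t < u \<and> u < length w \<and> P (w ! t) \<and> P (w ! u)"
    then obtain t u where "r < t" "t < u" "u < length w" "P (w ! t)" "P (w ! u)" by blast
    then show "2 \<le> length (filter P (drop (Suc r) w))"
      unfolding two_le_length_filter_iff
      by (intro exI[of _ "t - Suc r"] exI[of _ "u - Suc r"]) auto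
  qed
  then show ?thesis by (simp add: le_room_iff)
qed

lemma homogeneous_Nil [simp]: "homogeneous n []"
  by (simp add: homogeneous_def)

lemma homogeneous_snoc:
  "homogeneous n (w @ [a]) \<longleftrightarrow> homogeneous n w \<and> 2 \<le> room n w a"
proof -
  let ?v = "w @ [a]"
  let ?Q = "\<lambda>v r s. \<exists>t u. r < t \<and> t < u \<and> u < s \<and>
        neighbor n (v ! r) (v ! t) \<and> neighbor n (v ! r) (v ! u)"
  \<comment> \<open>The case \<open>s = length w\<close> is included: \<open>r\<close> and the
    witnesses lie strictly below \<open>s\<close>, so the new letter is never inspected.\<close>
  have same: "?Q ?v r s \<longleftrightarrow> ?Q w r s" if "r < s" "s \<le> length w" for r s
    using that by (intro ex_cong1) (auto simp: nth_append)
  have last: "(?v ! r = a \<longrightarrow> ?Q ?v r (length w)) \<longleftrightarrow> (w ! r = a \<longrightarrow>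
      (\<exists>t u. r < t \<and> t < u \<and> u < length w \<and> neighbor n a (w ! t) \<and> neighbor n a (w ! u)))"
    if "r < length w" for r
    unfolding same[OF that order_refl] using that by (auto simp: nth_append)
  have hom: "homogeneous n v \<longleftrightarrow> (\<forall>s < length v. \<forall>r < s. v ! r = v ! s \<longrightarrow> ?Q v r s)" for v
    unfolding homogeneous_def by blast
  have old: "(?v ! r = ?v ! s \<longrightarrow> ?Q ?v r s) \<longleftrightarrow> (w ! r = w ! s \<longrightarrow> ?Q w r s)"
    if "r < s" "s < length w" for r s
  proof -
    from that have Q: "?Q ?v r s \<longleftrightarrow> ?Q w r s" by (intro same) auto
    from that have nths: "?v ! r = w ! r" "?v ! s = w ! s" by (auto simp: nth_append)
    show ?thesis unfolding Q unfolding nths by (rule refl)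
  qed
  have "homogeneous n ?v \<longleftrightarrow>
      (\<forall>s < length w. \<forall>r < s. ?v ! r = ?v ! s \<longrightarrow> ?Q ?v r s) \<and>
      (\<forall>r < length w. ?v ! r = a \<longrightarrow> ?Q ?v r (length w))"
    unfolding hom length_append_singleton All_less_Suc nth_append_length by (rule conj_commute)
  also have "(\<forall>s < length w. \<forall>r < s. ?v ! r = ?v ! s \<longrightarrow> ?Q ?v r s) \<longleftrightarrow> homogeneous n w"
    unfolding hom by (intro all_cong old)
  also have "(\<forall>r < length w. ?v ! r = a \<longrightarrow> ?Q ?v r (length w)) \<longleftrightarrow> 2 \<le> room n w a"
    unfolding two_le_room_iff by (intro all_cong last)
  finally show ?thesis .
qed

lemma two_le_room_if_notin: "a \<notin> set w \<Longrightarrow> 2 \<le> room n w a"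
  by (induction w rule: rev_induct) auto

lemma homogeneous_appendD: "homogeneous n (v @ w) \<Longrightarrow> homogeneous n v"
  by (induction w rule: rev_induct) (simp_all add: homogeneous_snoc flip: append_assoc)

section \<open>The diagram and descending blocks\<close>

lemma neighbor_iff:
  "neighbor n a b \<longleftrightarrow> b = Suc a \<and> a \<in> {1..n - 2} \<or> a = Suc b \<and> b \<in> {1..n - 2} \<or>
    a = n - 2 \<and> b = n \<or> a = n \<and> b = n - 2"
  unfolding neighbor_def doubleton_eq_iff by auto

lemma neighbor_below:
  assumes "3 \<le> n" "1 \<le> a" "1 \<le> b" "a < n" "b < n"
  shows "neighbor n a b \<longleftrightarrow> a = Suc b \<or> b = Suc a"
  using assms unfolding neighbor_iff atLeastAtMost_iff by arith

lemma neighbor_top: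
  assumes "3 \<le> n" "a < n"
  shows "neighbor n a n \<longleftrightarrow> a = n - 2" "neighbor n n a \<longleftrightarrow> a = n - 2"
  using assms unfolding neighbor_iff atLeastAtMost_iff by arith+

text \<open>
  Since \<open>n\<close> and \<open>n - 1\<close> have the same neighbor \<open>n - 2\<close> among the smaller letters, the factors
  \<open>s\<^sub>m\<^sub>j\<close> with \<open>m < n\<close> and \<open>s\<^sub>n\<^sub>j\<close> have the common shape \<open>[t, m - 1, \<dots>, j]\<close>, where \<open>t = m\<close>, or
  \<open>t = n\<close> and \<open>m = n - 1\<close>. For \<open>j = m\<close> this is \<open>[t]\<close>, so that \<open>s\<^sub>n\<^sub>,\<^sub>n\<^sub>-\<^sub>1 = [n]\<close> is covered.
\<close>

definition block :: "nat \<Rightarrow> nat \<Rightarrow> nat \<Rightarrow> nat list" where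
  "block t m j = t # rev [j..<m]"

definition caps :: "nat \<Rightarrow> nat \<Rightarrow> nat \<Rightarrow> bool" where
  "caps n t m \<longleftrightarrow> 3 \<le> n \<and> 1 \<le> m \<and> m < n \<and> (t = m \<or> t = n \<and> m = n - 1)"

lemma caps_neighbor:
  assumes "caps n t m" "1 \<le> a" "a < m"
  shows "neighbor n t a \<longleftrightarrow> Suc a = m" "neighbor n a t \<longleftrightarrow> Suc a = m"
  using assms by (auto simp: caps_def neighbor_below neighbor_top)

lemma block_self: "block t m m = [t]"
  by (simp add: block_def)

text \<open>Lowering \<open>j\<close> appends one letter, so downward induction from
  \<open>j = m\<close> can use \<open>room_snoc\<close> and \<open>homogeneous_snoc\<close>.\<close>

lemma append_block_step: "j < m \<Longrightarrow> p @ block t m j = (p @ block t m (Suc j)) @ [j]"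
  by (simp add: block_def upt_conv_Cons)

text \<open>A letter from \<open>j\<close> on is reset inside the block and then sees only
  \<open>a - 1\<close>, if the block goes on that far. A letter below \<open>j\<close> can gain only
  from the last letter of the block.\<close>

lemma room_block:
  assumes "caps n t m" "1 \<le> j" "j \<le> m" "1 \<le> a" "a < m"
  shows "room n (p @ block t m j) a =
    (if a < j then room n p a + of_bool (Suc a = j) else of_bool (j < a))"
  using assms(3,2)
proof (induction rule: inc_induct)
  case base
  then show ?case using assms caps_neighbor[OF assms(1,4,5)]
    by (auto simp: block_self caps_def)
next
  case (step i)
  have "neighbor n a i \<longleftrightarrow> a = Suc i \<or> i = Suc a"
    using assms step by (intro neighbor_below) (auto simp: caps_def)
  then show ?case
    unfolding append_block_step[OF step.hyps(2)] room_snoc using step assms(4,5) by auto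
qed

lemma room_block_head:
  assumes "caps n t m" "1 \<le> j" "j \<le> m"
  shows "room n (p @ block t m j) t = of_bool (j < m)"
  using assms(3,2)
proof (induction rule: inc_induct)
  case base
  then show ?case by (auto simp: block_self)
next
  case (step i)
  have "t \<noteq> i" using assms(1) step by (auto simp: caps_def)
  then show ?case
    unfolding append_block_step[OF step.hyps(2)] room_snoc
    using step caps_neighbor[OF assms(1), of i] by auto
qed

text \<open>The letters \<open>n - 1\<close> and \<open>n\<close> are not neighbors, and the only
  smaller neighbor of either is \<open>n - 2\<close>, which the block contains iff
  \<open>j < n - 1\<close>.\<close>

lemma room_block_twin:
  assumes "3 \<le> n" "1 \<le> j" "j \<le> n - 1" "{t, u} = {n - 1, n}"
  shows "room n (p @ block t (n - 1) j) u = room n p u + of_bool (j < n - 1)"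
  using assms(3,2)
proof (induction rule: inc_induct)
  case base
  have "\<not> neighbor n u t" "u \<noteq> t"
    using assms(1,4) by (auto simp: doubleton_eq_iff neighbor_top)
  then show ?case by (auto simp: block_self)
next
  case (step i)
  have "caps n u (n - 1)" using assms(1,4) by (auto simp: caps_def doubleton_eq_iff)
  moreover have "u \<noteq> i" using assms(1,4) step by (auto simp: doubleton_eq_iff)
  ultimately show ?case
    unfolding append_block_step[OF step.hyps(2)] room_snoc
    using step caps_neighbor[of n u "n - 1" i] by auto
qed

text \<open>Each letter after the head gains one neighbor from its predecessor in the block, so it
  needs only one more from \<open>p\<close>; the head gains nothing and needs two.\<close>

lemma homogeneous_block:
  assumes "caps n t m" "1 \<le> j" "j \<le> m"
  shows "homogeneous n (p @ block t m j) \<longleftrightarrow>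
    homogeneous n p \<and> 2 \<le> room n p t \<and> (\<forall>a\<in>{j..<m}. 1 \<le> room n p a)"
  using assms(3,2)
proof (induction rule: inc_induct)
  case base
  then show ?case by (simp add: block_self homogeneous_snoc)
next
  case (step i)
  have "{i..<m} = insert i {Suc i..<m}" using step by auto
  moreover have "room n (p @ block t m (Suc i)) i = room n p i + 1"
    using room_block[OF assms(1), of "Suc i" i p] step by simp
  ultimately show ?case
    unfolding append_block_step[OF step.hyps(2)] homogeneous_snoc using step by auto
qed

section \<open>Prefixes and the splitting off of their last factor\<close>

lemma prefixes_one: "prefixes (Suc 0) = {[]}"
  unfolding prefixes_def by (auto intro!: exI[of _ "\<lambda>_. 1"])

text \<open>The choice \<open>i m = m + 1\<close> makes the last factor empty, which gives the first
  set of the union.\<close>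

lemma prefixes_Suc:
  assumes "1 \<le> m"
  shows "prefixes (Suc m) = prefixes m \<union> (\<Union>j\<in>{1..m}. (\<lambda>p. p @ block m m j) ` prefixes m)"
proof -
  let ?w = "\<lambda>n i. concat (map (\<lambda>l. seg n l (i l)) [1..<n])"
  let ?ok = "\<lambda>n i. \<forall>l. 1 \<le> l \<and> l \<le> n - 1 \<longrightarrow> 1 \<le> i l \<and> i l \<le> l + (1::nat)"
  have eq: "?w (Suc m) i = ?w m i @ rev [i m..<Suc m]" for i
  proof -
    \<comment> \<open>The indices are below \<open>m\<close>, so neither side enters the branch of
      \<open>seg\<close> for its top letter.\<close>
    have "map (\<lambda>l. seg (Suc m) l (i l)) [1..<m] = map (\<lambda>l. seg m l (i l)) [1..<m]"
      by (auto simp: seg_def)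
    moreover have "seg (Suc m) m (i m) = rev [i m..<Suc m]" by (simp add: seg_def)
    ultimately show ?thesis
      by (simp only: upt_Suc_append[OF assms] map_append concat_append list.map concat.simps
          append_Nil2)
  qed
  have blk: "rev [j..<Suc m] = (if j \<le> m then block m m j else [])" for j
    by (simp add: block_def)
  have upd: "?w m (i(m := j)) = ?w m i" for i j
    by (auto intro!: arg_cong[where f = concat])
  show ?thesis
  proof (intro equalityI subsetI)
    fix p assume "p \<in> prefixes (Suc m)"
    then obtain i where i: "?ok (Suc m) i" "p = ?w (Suc m) i" unfolding prefixes_def by blast
    have "?w m i \<in> prefixes m" unfolding prefixes_def using i(1) by fastforce
    moreover have "1 \<le> i m" "i m \<le> m + 1" using i(1) assms by auto
    ultimately show "p \<in> prefixes m \<union> (\<Union>j\<in>{1..m}. (\<lambda>p. p @ block m m j) ` prefixes m)"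
      unfolding i(2) eq blk by (cases "i m \<le> m") auto
  next
    fix q assume "q \<in> prefixes m \<union> (\<Union>j\<in>{1..m}. (\<lambda>p. p @ block m m j) ` prefixes m)"
    then obtain p j where pj: "p \<in> prefixes m" "1 \<le> j" "j \<le> m + 1" "q = p @ rev [j..<Suc m]"
    proof
      assume "q \<in> prefixes m"
      then show ?thesis by (intro that[of q "m + 1"]) auto
    next
      assume "q \<in> (\<Union>j\<in>{1..m}. (\<lambda>p. p @ block m m j) ` prefixes m)"
      then obtain p j where "p \<in> prefixes m" "j \<in> {1..m}" "q = p @ block m m j" by blast
      then show ?thesis using blk[of j] by (intro that[of p j]) auto
    qed
    obtain i where i: "?ok m i" "p = ?w m i" using pj(1) unfolding prefixes_def by blast
    have "q = ?w (Suc m) (i(m := j))" unfolding eq upd pj(4) i(2) by simp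
    moreover have "?ok (Suc m) (i(m := j))" using i(1) pj by auto
    ultimately show "q \<in> prefixes (Suc m)" unfolding prefixes_def by blast
  qed
qed

lemma set_prefixes:
  assumes "1 \<le> m" "p \<in> prefixes m"
  shows "set p \<subseteq> {1..<m}"
  using assms
proof (induction m arbitrary: p rule: dec_induct)
  case (step m)
  then show ?case by (fastforce simp: prefixes_Suc block_def)
qed (simp add: prefixes_one)

lemma room_prefix: "1 \<le> m \<Longrightarrow> p \<in> prefixes m \<Longrightarrow> m \<le> a \<Longrightarrow> 2 \<le> room n p a"
  using set_prefixes[of m p] by (intro two_le_room_if_notin) auto

lemma finite_prefixes: "1 \<le> m \<Longrightarrow> finite (prefixes m)"
  by (induction m rule: dec_induct) (simp_all add: prefixes_one prefixes_Suc)

text \<open>\<open>n\<close> fixes the diagram while \<open>m\<close> bounds the letters, so that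
  \<open>m\<close> can run in inductions; the set \<open>A\<close> collects letters that must not be
  right descents. \<open>G(m, k)\<close> is the case \<open>{k<..<m}\<close> and
  \<open>A(m, k)\<close> the case \<open>{k..<m - 1}\<close>.\<close>

definition room_prefixes :: "nat \<Rightarrow> nat \<Rightarrow> nat set \<Rightarrow> nat list set" where
  "room_prefixes n m A = {p \<in> prefixes m. homogeneous n p \<and> (\<forall>a\<in>A. 1 \<le> room n p a)}"

lemma finite_room_prefixes: "1 \<le> m \<Longrightarrow> finite (room_prefixes n m A)"
  by (simp add: room_prefixes_def finite_prefixes)

text \<open>As \<open>m\<close> is missing from \<open>p\<close> and \<open>q\<close>, its first
  occurrence marks the start of the block, whose length then gives \<open>j\<close>.\<close>

lemma append_block_inj:
  assumes "p @ block m m j = q @ block m m l" "m \<notin> set p" "m \<notin> set q" "j \<le> m" "l \<le> m"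
  shows "p = q \<and> j = l"
proof -
  have *: "takeWhile (\<lambda>x. x \<noteq> m) (r @ block m m i) = r" if "m \<notin> set r" for r i
    using that by (subst takeWhile_append2) (auto simp: block_def)
  have "p = q" using *[of p j] *[of q l] assms by simp
  moreover have "length (block m m j) = length (block m m l)"
    using assms(1) \<open>p = q\<close> by simp
  ultimately show ?thesis using assms by (simp add: block_def)
qed

lemma homogeneous_prefix_block:
  assumes "3 \<le> n" "m < n" "1 \<le> m" "p \<in> prefixes m" "1 \<le> j" "j \<le> m"
  shows "homogeneous n (p @ block m m j) \<longleftrightarrow> p \<in> room_prefixes n m {j..<m}"
  using assms homogeneous_block[of n m m j p] room_prefix[of m p m n]
  by (auto simp: caps_def room_prefixes_def)

lemma room_prefix_block:
  assumes "3 \<le> n" "m < n" "1 \<le> m" "1 \<le> j" "j \<le> m" "1 \<le> a" "a \<le> m"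
  shows "room n (p @ block m m j) a =
    (if a < j then room n p a + of_bool (Suc a = j) else of_bool (j < a))"
  using assms room_block[of n m m j a p] room_block_head[of n m m j p]
  by (cases "a = m") (auto simp: caps_def)

lemma room_prefixes_Suc:
  assumes "3 \<le> n" "1 \<le> m" "m < n" "k \<le> m"
  shows "room_prefixes n (Suc m) {k<..<Suc m} =
    room_prefixes n m {k<..<m} \<union>
    (\<Union>j<k. (\<lambda>p. p @ block m m (Suc j)) ` room_prefixes n m {j<..<m})" (is "?L = ?R")
proof -
  have ivl: "{Suc j..<m} = {j<..<m}" for j by auto
  have plain: "p \<in> room_prefixes n (Suc m) {k<..<Suc m} \<longleftrightarrow> p \<in> room_prefixes n m {k<..<m}"
    if "p \<in> prefixes m" for p
    using that assms room_prefix[of m p m n]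
    by (auto simp: room_prefixes_def prefixes_Suc less_Suc_eq)
  have blk: "p @ block m m j \<in> ?L \<longleftrightarrow> j \<le> k \<and> p \<in> room_prefixes n m {j..<m}"
    if "p \<in> prefixes m" "1 \<le> j" "j \<le> m" for p j
  proof -
    have "p @ block m m j \<in> prefixes (Suc m)" using that assms by (auto simp: prefixes_Suc)
    then have "p @ block m m j \<in> ?L \<longleftrightarrow> p \<in> room_prefixes n m {j..<m} \<and>
        (\<forall>a\<in>{k<..<Suc m}. 1 \<le> room n (p @ block m m j) a)"
      using that assms homogeneous_prefix_block by (simp add: room_prefixes_def[of _ "Suc m"])
    moreover have "(\<forall>a\<in>{k<..<Suc m}. 1 \<le> room n (p @ block m m j) a) \<longleftrightarrow> j \<le> k"
      if p: "p \<in> room_prefixes n m {j..<m}"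
    proof
      assume "\<forall>a\<in>{k<..<Suc m}. 1 \<le> room n (p @ block m m j) a"
      moreover have "room n (p @ block m m j) j = 0"
        using that assms \<open>1 \<le> j\<close> \<open>j \<le> m\<close> by (simp add: room_prefix_block)
      ultimately have "j \<notin> {k<..<Suc m}" by force
      then show "j \<le> k" using \<open>j \<le> m\<close> by auto
    next
      assume "j \<le> k"
      then show "\<forall>a\<in>{k<..<Suc m}. 1 \<le> room n (p @ block m m j) a"
        using assms \<open>1 \<le> j\<close> \<open>j \<le> m\<close> by (auto simp: room_prefix_block)
    qed
    ultimately show ?thesis by blast
  qed
  show ?thesis
  proof (intro equalityI subsetI)
    fix q assume q: "q \<in> ?L"
    then have "q \<in> prefixes (Suc m)" by (simp add: room_prefixes_def)
    then consider "q \<in> prefixes m"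
      | p j where "p \<in> prefixes m" "1 \<le> j" "j \<le> m" "q = p @ block m m j"
      using assms by (auto simp: prefixes_Suc)
    then show "q \<in> ?R"
    proof cases
      case 1
      then show ?thesis using q plain by blast
    next
      case 2
      then have "j \<le> k" "p \<in> room_prefixes n m {j - 1<..<m}"
        using q blk[of p j] ivl[of "j - 1"] by auto
      then show ?thesis using 2 by (auto intro!: bexI[of _ "j - 1"])
    qed
  next
    fix q assume "q \<in> ?R"
    then consider "q \<in> room_prefixes n m {k<..<m}"
      | p j where "p \<in> room_prefixes n m {j<..<m}" "j < k" "q = p @ block m m (Suc j)" by blast
    then show "q \<in> ?L"
    proof cases
      case 1
      then show ?thesis using plain by (auto simp: room_prefixes_def)
    next
      case 2
      then show ?thesis using blk[of p "Suc j"] ivl[of j] assms by (auto simp: room_prefixes_def)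
    qed
  qed
qed

section \<open>The counts as entries of Catalan's triangle\<close>

lemma catalan_triangle_Suc_eq_sum:
  "k \<le> n \<Longrightarrow> catalan_triangle (Suc n) k = (\<Sum>j\<le>k. catalan_triangle n j)"
  by (induction k) auto

lemma card_room_prefixes_above:
  assumes "3 \<le> n" "1 \<le> m" "m \<le> n" "k \<le> m"
  shows "card (room_prefixes n m {k<..<m}) = catalan_triangle m k"
  using assms(2-)
proof (induction m arbitrary: k rule: dec_induct)
  case base
  have words: "room_prefixes n 1 {k<..<1} = {[]}"
    by (auto simp: room_prefixes_def prefixes_one)
  have "k = 0 \<or> k = 1" using base by auto
  then have one: "catalan_triangle 1 k = 1" by auto
  show ?case unfolding words one by simp
next
  case (step m)
  have main: "card (room_prefixes n (Suc m) {k<..<Suc m}) = catalan_triangle (Suc m) k"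
    if "k \<le> m" for k
  proof -
    let ?F = "\<lambda>j. (\<lambda>p. p @ block m m (Suc j)) ` room_prefixes n m {j<..<m}"
    have m: "1 \<le> m" "m < n" using step.hyps step.prems by auto
    have new: "m \<notin> set p" if "p \<in> room_prefixes n m A" for p A
      using that set_prefixes[OF m(1)] by (force simp: room_prefixes_def)
    have "card (\<Union>j<k. ?F j) = (\<Sum>j<k. card (?F j))"
    proof (rule card_UN_disjoint)
      show "\<forall>i\<in>{..<k}. \<forall>j\<in>{..<k}. i \<noteq> j \<longrightarrow> ?F i \<inter> ?F j = {}"
      proof (intro ballI impI)
        fix i j assume ij: "i \<in> {..<k}" "j \<in> {..<k}" "i \<noteq> j"
        have "p @ block m m (Suc i) \<noteq> q @ block m m (Suc j)"
          if "p \<in> room_prefixes n m {i<..<m}" "q \<in> room_prefixes n m {j<..<m}" for p q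
          using append_block_inj[of p m "Suc i" q "Suc j"] new that ij \<open>k \<le> m\<close> by auto
        then show "?F i \<inter> ?F j = {}" by blast
      qed
    qed (simp_all add: finite_room_prefixes[OF m(1)])
    also have "\<dots> = (\<Sum>j<k. catalan_triangle m j)"
    proof (rule sum.cong)
      fix j assume "j \<in> {..<k}"
      moreover have "card (?F j) = card (room_prefixes n m {j<..<m})"
        by (simp add: card_image inj_on_def)
      ultimately show "card (?F j) = catalan_triangle m j"
        using step.IH[of j] m that by simp
    qed simp
    finally have "card (\<Union>j<k. ?F j) = (\<Sum>j<k. catalan_triangle m j)" .
    moreover have "card (room_prefixes n m {k<..<m} \<union> (\<Union>j<k. ?F j)) =
      card (room_prefixes n m {k<..<m}) + card (\<Union>j<k. ?F j)"
    proof (rule card_Un_disjoint)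
      have old: "m \<in> set q" if "q \<in> (\<Union>j<k. ?F j)" for q
        using that by (auto simp: block_def)
      show "room_prefixes n m {k<..<m} \<inter> (\<Union>j<k. ?F j) = {}"
      proof (rule equals0I)
        fix q assume q: "q \<in> room_prefixes n m {k<..<m} \<inter> (\<Union>j<k. ?F j)"
        show False using old[OF IntD2[OF q]] new[OF IntD1[OF q]] by contradiction
      qed
    qed (simp_all add: finite_room_prefixes[OF m(1)])
    moreover have "card (room_prefixes n m {k<..<m}) = catalan_triangle m k"
      using step.IH[of k] m that by simp
    ultimately show ?thesis
      unfolding room_prefixes_Suc[OF assms(1) m that] catalan_triangle_Suc_eq_sum[OF that]
      by (simp flip: lessThan_Suc_atMost)
  qed
  show ?case
  proof (cases "k \<le> m")
    case True
    then show ?thesis by (rule main)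
  next
    case False
    then have "k = Suc m" using step.prems by simp
    \<comment> \<open>Both intervals are empty, which mirrors the equality of the last two entries
      in a row of the triangle.\<close>
    moreover have "{Suc m<..<Suc m} = {m<..<Suc m}" by auto
    ultimately show ?thesis using main[of m] by (simp del: greaterThanLessThan_empty)
  qed
qed

text \<open>The words are split by whether \<open>m\<close> is a right descent. If it is, the last
  factor must be \<open>[m]\<close>: an empty one leaves \<open>m\<close> new, and a longer one puts
  \<open>m - 1\<close> after it. Appending \<open>m\<close> gives \<open>m - 1\<close> a neighbor,
  so the shorter word is constrained only below \<open>m - 1\<close>.\<close>

lemma room_prefixes_Suc_below_last:
  assumes "3 \<le> n" "1 \<le> k" "k \<le> m" "m < n"
  shows "room_prefixes n (Suc m) {k..<m} =
    room_prefixes n (Suc m) {k - 1<..<Suc m} \<union> (\<lambda>p. p @ [m]) ` room_prefixes n m {k..<m - 1}"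
    (is "?L = ?G \<union> ?A")
proof -
  have m: "1 \<le> m" using assms by simp
  have ivl: "{k - 1<..<Suc m} = insert m {k..<m}" using assms by auto
  have last: "p @ [m] \<in> ?L \<longleftrightarrow> p \<in> room_prefixes n m {k..<m - 1}" if "p \<in> prefixes m" for p
  proof -
    have "p @ [m] \<in> prefixes (Suc m)"
      using that m by (auto simp: prefixes_Suc simp flip: block_self[of m m])
    moreover have "homogeneous n (p @ [m]) \<longleftrightarrow> homogeneous n p"
      using room_prefix[OF m that, of m n] by (simp add: homogeneous_snoc)
    moreover have "(\<forall>a\<in>{k..<m}. 1 \<le> room n (p @ [m]) a) \<longleftrightarrow> (\<forall>a\<in>{k..<m - 1}. 1 \<le> room n p a)"
    proof -
      have "1 \<le> room n (p @ [m]) a \<longleftrightarrow> a = m - 1 \<or> 1 \<le> room n p a" if "a \<in> {k..<m}" for a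
        using room_prefix_block[of n m m a p] assms that m by (auto simp: block_self)
      moreover have "{k..<m - 1} = {k..<m} - {m - 1}" by auto
      ultimately show ?thesis by auto
    qed
    ultimately show ?thesis using that by (simp add: room_prefixes_def)
  qed
  have "p \<in> ?G \<union> ?A" if p: "p \<in> ?L" for p
  proof (cases "1 \<le> room n p m")
    case True
    then show ?thesis using p ivl by (auto simp: room_prefixes_def)
  next
    case False
    then have "p \<notin> prefixes m" using room_prefix[OF m, of p m n] by auto
    moreover have "p \<in> prefixes (Suc m)" using p by (simp add: room_prefixes_def)
    ultimately obtain q j where q: "q \<in> prefixes m" "1 \<le> j" "j \<le> m" "p = q @ block m m j"
      using m by (auto simp: prefixes_Suc)
    then have "j = m" using False assms m room_prefix_block[of n m j m q]
      by (cases "j < m") auto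
    then show ?thesis using q last p by (auto simp: block_self)
  qed
  moreover have "?G \<subseteq> ?L" using ivl by (auto simp: room_prefixes_def)
  moreover have "?A \<subseteq> ?L"
  proof (rule image_subsetI)
    fix p assume p: "p \<in> room_prefixes n m {k..<m - 1}"
    then have "p \<in> prefixes m" by (simp add: room_prefixes_def)
    then show "p @ [m] \<in> ?L" using last p by blast
  qed
  ultimately show ?thesis by blast
qed

lemma card_room_prefixes_below_last:
  assumes "3 \<le> n" "1 \<le> k" "k \<le> m" "m \<le> n"
  shows "card (room_prefixes n m {k..<m - 1}) = catalan_triangle m k"
  using assms(3,4)
proof (induction m rule: dec_induct)
  case base
  \<comment> \<open>On the diagonal neither family forbids any descent, so
    \<open>A(k, k) = G(k, k)\<close> and the recursion starts from the previous count.\<close>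
  have "{k..<k - 1} = {k<..<k}" by auto
  then show ?case using card_room_prefixes_above[of n k k] assms base
    by (simp del: greaterThanLessThan_empty)
next
  case (step m)
  let ?G = "room_prefixes n (Suc m) {k - 1<..<Suc m}"
  let ?A = "(\<lambda>p. p @ [m]) ` room_prefixes n m {k..<m - 1}"
  have "room n p m = 0" if "p \<in> ?A" for p using that by auto
  moreover have "1 \<le> room n p m" if "p \<in> ?G" for p
    using that step assms by (auto simp: room_prefixes_def)
  ultimately have "?G \<inter> ?A = {}" by fastforce
  then have "card (?G \<union> ?A) = card ?G + card ?A"
    using step assms by (intro card_Un_disjoint) (auto simp: finite_room_prefixes)
  also have "card ?A = catalan_triangle m k"
    using step by (subst card_image) (auto simp: inj_on_def)
  also have "card ?G = catalan_triangle (Suc m) (k - 1)"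
    using step assms by (intro card_room_prefixes_above) auto
  also have "catalan_triangle (Suc m) (k - 1) + catalan_triangle m k = catalan_triangle (Suc m) k"
    using step assms by (cases k) auto
  finally show ?case
    using room_prefixes_Suc_below_last[of n k m] step assms by simp
qed

section \<open>Suffixes as alternating blocks\<close>

lemma seg_eq_block:
  assumes "3 \<le> n" "1 \<le> j" "j \<le> n - 1" "t = n \<or> t = n - 1"
  shows "seg n t j = block t (n - 1) j"
proof -
  have "Suc (n - 2) = n - 1" using assms by simp
  then show ?thesis using assms unfolding seg_def block_def by auto
qed

lemma suffix_word_singleton: "suffix_word n [j] = seg n n j"
  by (simp add: suffix_word_def)

text \<open>Exchanging \<open>t\<close> and \<open>u\<close> in the recursive call replaces the
  parity of positions, so that induction on \<open>js\<close> applies.\<close>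

fun blocks :: "nat \<Rightarrow> nat \<Rightarrow> nat \<Rightarrow> nat list \<Rightarrow> nat list" where
  "blocks n t u [] = []"
| "blocks n t u (j # js) = block t (n - 1) j @ blocks n u t js"

lemma concat_seg_eq_blocks:
  assumes "3 \<le> n" "set js \<subseteq> {1..n - 1}" "t = n \<and> u = n - 1 \<or> t = n - 1 \<and> u = n"
  shows "concat (map (\<lambda>r. seg n (if even r then t else u) (js ! r)) [0..<length js]) = blocks n t u js"
  using assms(2,3)
proof (induction js arbitrary: t u)
  case (Cons j js)
  have "concat (map (\<lambda>r. seg n (if even r then t else u) ((j # js) ! r)) [0..<length (j # js)])
    = seg n t j @ concat (map (\<lambda>r. seg n (if even r then u else t) (js ! r)) [0..<length js])"
    by (simp add: upt_conv_Cons map_Suc_upt[symmetric] o_def if_distrib del: upt_Suc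
        cong: if_cong)
      (auto intro!: arg_cong[where f = concat])
  then show ?case using Cons seg_eq_block[OF assms(1)] by auto
qed simp

lemma suffix_word_eq_blocks:
  assumes "3 \<le> n" "js \<in> suffix_indices n"
  shows "suffix_word n js = blocks n n (n - 1) js"
  using concat_seg_eq_blocks[of n js n "n - 1"] assms
  by (simp add: suffix_word_def suffix_indices_def)

text \<open>The hypotheses on \<open>p\<close> form an invariant, with \<open>i\<close> standing for
  the index of the preceding factor. If a further factor follows, then \<open>j < n - 1\<close> and
  the block contains \<open>n - 2\<close>: this lifts \<open>u\<close> to at least 2 and leaves
  \<open>t\<close> and the letters between \<open>j\<close> and \<open>n - 1\<close> at 1, so
  \<open>t\<close> and \<open>u\<close> swap roles.\<close>

lemma homogeneous_blocks:
  assumes "3 \<le> n" "{t, u} = {n - 1, n}" "homogeneous n p"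
    "sorted_wrt (<) (i # js)" "set js \<subseteq> {1..n - 1}"
    "2 \<le> room n p t" "1 \<le> room n p u" "\<forall>a\<in>{i<..<n - 1}. 1 \<le> room n p a"
  shows "homogeneous n (p @ blocks n t u js)"
  using assms(2-)
proof (induction js arbitrary: p t u i)
  case (Cons j js)
  have j: "1 \<le> j" "j \<le> n - 1" "i < j" using Cons.prems by auto
  have caps: "caps n t (n - 1)"
    using Cons.prems(1) assms(1) by (auto simp: caps_def doubleton_eq_iff)
  let ?q = "p @ block t (n - 1) j"
  have hom: "homogeneous n ?q"
    using Cons.prems j by (subst homogeneous_block[OF caps]) auto
  show ?case
  proof (cases js)
    case Nil
    then show ?thesis using hom by simp
  next
    case (Cons l ls)
    then have "j < n - 1" using Cons.prems by auto
    moreover have "room n ?q a = 1" if "a \<in> {j<..<n - 1}" for a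
      using that j room_block[OF caps, of j a p] by simp
    ultimately have "homogeneous n (?q @ blocks n u t js)"
      using j Cons.prems hom room_block_head[OF caps, of j p]
        room_block_twin[OF assms(1) j(1,2) Cons.prems(1), of p]
      by (intro Cons.IH[of u t ?q j]) (auto simp: insert_commute)
    then show ?thesis by simp
  qed
qed simp

text \<open>The first factor forbids descents from \<open>j\<close> to \<open>n - 2\<close>. The
  second needs room 2 at \<open>n - 1\<close>, of which the first factor supplies one, so
  \<open>n - 1\<close> must not be a descent either. Later factors add no condition, hence only
  \<open>hd js\<close> matters.\<close>

lemma homogeneous_append_long_suffix:
  assumes "3 \<le> n" "p \<in> prefixes n" "js \<in> suffix_indices n" "2 \<le> length js"
  shows "homogeneous n (p @ suffix_word n js) \<longleftrightarrow> p \<in> room_prefixes n n {hd js..<n}"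
proof -
  obtain j l ls where js: "js = j # l # ls"
    using assms(4) by (cases js; cases "tl js") auto
  have j: "1 \<le> j" "j < n - 1" "j < l" "1 \<le> l" "l \<le> n - 1" "set (l # ls) \<subseteq> {1..n - 1}"
    "sorted_wrt (<) (j # l # ls)"
    using assms(3) unfolding js suffix_indices_def by auto
  have caps: "caps n n (n - 1)" "caps n (n - 1) (n - 1)" using assms(1) by (auto simp: caps_def)
  have top: "2 \<le> room n p n" using room_prefix[of n p n n] assms by simp
  let ?q = "p @ block n (n - 1) j"
  have word: "p @ suffix_word n js = ?q @ blocks n (n - 1) n (l # ls)"
    using suffix_word_eq_blocks[OF assms(1,3)] by (simp add: js)
  have q: "homogeneous n ?q \<longleftrightarrow> homogeneous n p \<and> (\<forall>a\<in>{j..<n - 1}. 1 \<le> room n p a)"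
    using homogeneous_block[OF caps(1), of j p] j top by simp
  have twin: "room n ?q (n - 1) = room n p (n - 1) + 1"
    using room_block_twin[of n j n "n - 1" p] assms(1) j by (simp add: insert_commute)
  have "homogeneous n (p @ suffix_word n js) \<longleftrightarrow> homogeneous n ?q \<and> 2 \<le> room n ?q (n - 1)"
  proof
    assume hom: "homogeneous n (p @ suffix_word n js)"
    then have "homogeneous n (?q @ block (n - 1) (n - 1) l)"
      unfolding word using homogeneous_appendD[of n "?q @ block (n - 1) (n - 1) l"] by simp
    then show "homogeneous n ?q \<and> 2 \<le> room n ?q (n - 1)"
      using homogeneous_block[OF caps(2)] j by blast
  next
    assume "homogeneous n ?q \<and> 2 \<le> room n ?q (n - 1)"
    moreover have "room n ?q n = 1" using room_block_head[OF caps(1), of j p] j by simp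
    moreover have "room n ?q a = 1" if "a \<in> {j<..<n - 1}" for a
      using that j room_block[OF caps(1), of j a p] by simp
    ultimately show "homogeneous n (p @ suffix_word n js)"
      unfolding word using j assms(1) by (intro homogeneous_blocks[where i = j]) auto
  qed
  moreover have "{hd js..<n} = insert (n - 1) {j..<n - 1}" using j js by auto
  ultimately show ?thesis using q twin assms(2) by (auto simp: room_prefixes_def)
qed

text \<open>Without a second factor there is no condition at \<open>n - 1\<close>, in contrast to a
  long suffix.\<close>

lemma homogeneous_append_seg:
  assumes "3 \<le> n" "p \<in> prefixes n" "1 \<le> j" "j \<le> n - 1"
  shows "homogeneous n (p @ seg n n j) \<longleftrightarrow> p \<in> room_prefixes n n {j..<n - 1}"
proof -
  have "caps n n (n - 1)" using assms(1) by (auto simp: caps_def)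
  moreover have "2 \<le> room n p n" using room_prefix[of n p n n] assms by simp
  ultimately show ?thesis
    using assms seg_eq_block[of n j n] homogeneous_block[of n n "n - 1" j p]
    by (auto simp: room_prefixes_def)
qed

section \<open>The size of each collection\<close>

lemma card_collection:
  assumes "w \<in> suffixes n"
    and "\<And>p. p \<in> prefixes n \<Longrightarrow> homogeneous n (p @ w) \<longleftrightarrow> p \<in> room_prefixes n n A"
  shows "card (collection n w) = card (room_prefixes n n A)"
proof -
  have "collection n w = (\<lambda>p. p @ w) ` room_prefixes n n A"
    using assms unfolding collection_def canonical_words_def
    by (auto simp: room_prefixes_def)
  then show ?thesis by (simp add: card_image inj_on_def)
qed

lemma card_collection_long_suffix:
  assumes "3 \<le> n" "k < n" "w \<in> long_suffixes_from n (Suc k)"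
  shows "card (collection n w) = catalan_triangle n k"
proof -
  obtain js where js: "js \<in> suffix_indices n" "2 \<le> length js" "hd js = Suc k" "w = suffix_word n js"
    using assms(3) unfolding long_suffixes_from_def by blast
  have "{hd js..<n} = {k<..<n}" using js(3) by auto
  then have "card (collection n w) = card (room_prefixes n n {k<..<n})"
    using js homogeneous_append_long_suffix[OF assms(1)]
    by (intro card_collection) (auto simp: suffixes_def)
  then show ?thesis using card_room_prefixes_above[of n n k] assms by simp
qed

lemma card_collection_seg:
  assumes "3 \<le> n" "1 \<le> k" "k \<le> n - 1"
  shows "card (collection n (seg n n k)) = catalan_triangle n k"
proof -
  have "[k] \<in> suffix_indices n" using assms by (simp add: suffix_indices_def)
  then have "seg n n k \<in> suffixes n" unfolding suffixes_def suffix_word_singleton[symmetric]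
    by blast
  then have "card (collection n (seg n n k)) = card (room_prefixes n n {k..<n - 1})"
    using homogeneous_append_seg assms by (intro card_collection) auto
  then show ?thesis using card_room_prefixes_below_last[of n k n] assms by simp
qed

lemma card_collection_Nil:
  assumes "3 \<le> n"
  shows "card (collection n []) = catalan_triangle n n"
proof -
  have "[] = suffix_word n []" "[] \<in> suffix_indices n"
    by (simp_all add: suffix_word_def suffix_indices_def)
  then have "[] \<in> suffixes n" unfolding suffixes_def by blast
  then have "card (collection n []) = card (room_prefixes n n {n<..<n})"
    by (intro card_collection) (auto simp: room_prefixes_def)
  then show ?thesis using card_room_prefixes_above[of n n n] assms by simp
qed

theorem theorem2p12:
  fixes n k :: nat and c :: "nat list set"
  assumes "n \<ge> 4" and "k \<le> n" and "c \<in> packet n k"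
  shows "card c = catalan_triangle n k"
proof -
  obtain w where w: "w \<in> packet_labels n k" "c = collection n w"
    using assms(3) unfolding packet_def by blast
  \<comment> \<open>Both words are \<open>[n]\<close>, so the label of the packet with
    \<open>k = n - 1\<close> also has the form \<open>seg n n k\<close>.\<close>
  have top: "seg n n n = seg n n (n - 1)" using assms(1) unfolding seg_def by simp arith
  have "w \<in> long_suffixes_from n (Suc k) \<and> k < n \<or> w = seg n n k \<and> 1 \<le> k \<and> k \<le> n - 1
      \<or> w = [] \<and> k = n"
    using w(1) assms(1,2) top unfolding packet_labels_def by (auto split: if_splits)
  then show ?thesis
    using assms(1) w(2) card_collection_long_suffix card_collection_seg card_collection_Nil by auto
qed

end
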